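(* Let $n\ge 1$ and let $G$ be an abelian subgroup of $GL(n,\mathbb{C})$. Then for every $u\in\mathbb{C}^n$ there exists a $G$-invariant dense open subset $U_u$ of $E(u)$, containing $u$, such that: (i) for every $v\in U_u$, $E(v)=E(u)$; (ii) all orbits of $G$ in $U_u$ are isomorphic; (iii) $E(u)\setminus U_u$ is a union of at most $r(u)$ $G$-invariant complex vector subspaces of $E(u)$, each of dimension $r(u)-1$ over $\mathbb{C}$.
   Context: $G$ acts on $\mathbb{C}^n$ by $(A,v)\mapsto Av$. For $u\in\mathbb{C}^n$, $G(u)=\{Au : A\in G\}$ is the orbit of $u$, $E(u)=\mathrm{vect}(G(u))$ is the complex vector subspace of $\mathbb{C}^n$ spanned by $G(u)$, and $r(u)=\dim_{\mathbb{C}}E(u)$. A subset $S\subset\mathbb{C}^n$ is $G$-invariant if $A(S)\subset S$ for all $A\in G$. Two orbits $G(v)$, $G(w)$ are called isomorphic if there is a complex linear isomorphism $B:E(v)\to E(w)$ with $B(G(v))=G(w)$. *)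

theory Defs
  imports "HOL-Analysis.Analysis" "HOL-Algebra.Group"
begin

text \<open>
  All linear algebra is over the complex numbers: \<open>vec.span\<close>, \<open>vec.subspace\<close> and \<open>vec.dim\<close>
  refer to scalar multiplication \<open>c *s x\<close> by complex scalars, whereas the plain \<open>span\<close>,
  \<open>subspace\<close> and \<open>dim\<close> would be the real notions.
\<close>

definition GL :: "(complex^'n^'n) monoid" where
  "GL = \<lparr>carrier = {A. invertible A}, mult = (\<lambda>A B. A ** B), one = mat 1\<rparr>"

lemma group_GL: "group GL"
proof (rule groupI)
  fix A :: "complex^'n^'n"
  assume "A \<in> carrier GL"
  then obtain A' where "A ** A' = mat 1" "A' ** A = mat 1"
    by (auto simp: GL_def invertible_def)
  then show "\<exists>B\<in>carrier GL. B \<otimes>\<^bsub>GL\<^esub> A = \<one>\<^bsub>GL\<^esub>"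
    by (auto simp: GL_def invertible_def)
qed (auto simp: GL_def matrix_mul_assoc intro: invertible_mult, auto simp: invertible_def)

definition abelian_subgroup_GL :: "(complex^'n^'n) set \<Rightarrow> bool" where
  "abelian_subgroup_GL G \<longleftrightarrow>
     subgroup G GL \<and> (\<forall>A\<in>G. \<forall>B\<in>G. A ** B = B ** A)"

definition orbit :: "(complex^'n^'n) set \<Rightarrow> complex^'n \<Rightarrow> (complex^'n) set" where
  "orbit G u = {A *v u |A. A \<in> G}"

definition orbit_span :: "(complex^'n^'n) set \<Rightarrow> complex^'n \<Rightarrow> (complex^'n) set" where
  "orbit_span G u = vec.span (orbit G u)"

definition orbit_rank :: "(complex^'n^'n) set \<Rightarrow> complex^'n \<Rightarrow> nat" where
  "orbit_rank G u = vec.dim (orbit_span G u)"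

definition invariant :: "(complex^'n^'n) set \<Rightarrow> (complex^'n) set \<Rightarrow> bool" where
  "invariant G S \<longleftrightarrow> (\<forall>A\<in>G. (\<lambda>x. A *v x) ` S \<subseteq> S)"

text \<open>
  The library predicate \<open>Vector_Spaces.linear\<close> concerns maps on a whole type, so linearity of a
  map defined on a subspace \<open>V\<close> is spelled out; the values of \<open>B\<close> outside \<open>V\<close> are irrelevant.
\<close>

definition linear_iso_between ::
  "(complex^'n \<Rightarrow> complex^'n) \<Rightarrow> (complex^'n) set \<Rightarrow> (complex^'n) set \<Rightarrow> bool" where
  "linear_iso_between B V W \<longleftrightarrow>
     (\<forall>x\<in>V. \<forall>y\<in>V. B (x + y) = B x + B y) \<and>
     (\<forall>c. \<forall>x\<in>V. B (c *s x) = c *s B x) \<and>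
     bij_betw B V W"

definition isomorphic_orbits :: "(complex^'n^'n) set \<Rightarrow> complex^'n \<Rightarrow> complex^'n \<Rightarrow> bool" where
  "isomorphic_orbits G v w \<longleftrightarrow>
     (\<exists>B. linear_iso_between B (orbit_span G v) (orbit_span G w) \<and> B ` orbit G v = orbit G w)"

end

theory Submission
  imports Defs "HOL-Computational_Algebra.Fundamental_Theorem_Algebra"
begin

text \<open>
  Write \<open>E\<close> for \<open>orbit_span G u\<close> and let \<open>\<A>\<close> be the commutative algebra of operators generated
  by \<open>G\<close>. Then \<open>E = \<A> u\<close>, and an operator in \<open>\<A>\<close> is determined on \<open>E\<close> by its value at \<open>u\<close>
  because it commutes with the rest of \<open>\<A>\<close>. So \<open>E\<close> is a copy of the finite-dimensional
  commutative algebra \<open>\<A>|E\<close>, in which \<open>u\<close> plays the role of 1 and the \<open>G\<close>-invariant subspaces are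
  the ideals. A vector \<open>v = f u\<close> satisfies \<open>orbit_span G v = f(E)\<close>, so it generates \<open>E\<close> exactly
  when it is a unit; the set \<open>U\<close> of the theorem is this set of units. The theorem becomes a list of
  familiar facts on such an algebra over the complex numbers.

  The nonunits are the union of the maximal ideals, and every maximal ideal has codimension 1
  (\<open>ex_invariant_hyperplane\<close>): modulo a maximal invariant subspace each \<open>A \<in> G\<close> must act as a
  scalar, because some \<open>A - z\<close> is not onto there and its image is again invariant. That such a \<open>z\<close>
  exists is the place where algebraic closedness is used (\<open>ex_shift_not_onto\<close>).

  There are at most \<open>dim E\<close> maximal ideals (\<open>card_invariant_hyperplanes\<close>): each of them is prime,
  so it does not contain the intersection of finitely many others, and intersecting them one after
  the other lowers the dimension at every step.

  Hence the complement of \<open>U\<close> in \<open>E\<close> is a finite union of hyperplanes, none of which contains \<open>u\<close>.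
  This makes \<open>U\<close> open, and dense because a line in direction \<open>u\<close> meets each hyperplane at most once.
  Finally, if \<open>v\<close> and \<open>w\<close> generate the same subspace, an operator in \<open>\<A>\<close> that takes \<open>v\<close> to \<open>w\<close>
  is invertible there and commutes with \<open>G\<close>, so it carries the orbit of \<open>v\<close> onto that of \<open>w\<close>.
\<close>

section \<open>Complex subspaces of complex vectors\<close>

lemma real_subspace_of_complex_subspace:
  fixes W :: "(complex^'n) set"
  assumes "vec.subspace W"
  shows "subspace W"
proof -
  have "c *\<^sub>R x = complex_of_real c *s x" for c and x :: "complex^'n"
    by (simp add: vec_eq_iff scaleR_conv_of_real[symmetric])
  then show ?thesis
    using assms by (simp add: subspace_def vec.subspace_def)
qed

lemma closed_complex_subspace:
  fixes W :: "(complex^'n) set"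
  assumes "vec.subspace W"
  shows "closed W"
  using assms real_subspace_of_complex_subspace closed_subspace by blast

section \<open>The algebra of operators generated by a set of matrices\<close>

text \<open>
  The operators are functions rather than matrices, so that scalar multiples and compositions need
  no translation into matrix arithmetic. There is no rule for the identity: for a group it comes
  from the identity matrix.
\<close>

inductive_set operator_algebra ::
  "(complex^'n^'n) set \<Rightarrow> (complex^'n \<Rightarrow> complex^'n) set" for G where
  gen: "A \<in> G \<Longrightarrow> (*v) A \<in> operator_algebra G"
| add: "f \<in> operator_algebra G \<Longrightarrow> g \<in> operator_algebra G \<Longrightarrow> (\<lambda>x. f x + g x) \<in> operator_algebra G"
| scale: "f \<in> operator_algebra G \<Longrightarrow> (\<lambda>x. c *s f x) \<in> operator_algebra G"
| comp: "f \<in> operator_algebra G \<Longrightarrow> g \<in> operator_algebra G \<Longrightarrow> (\<lambda>x. f (g x)) \<in> operator_algebra G"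

lemma operator_algebra_linear:
  assumes "f \<in> operator_algebra G"
  shows "Vector_Spaces.linear (*s) (*s) f"
  using assms
proof induction
  case (comp f g)
  then show ?case
    using Vector_Spaces.linear_compose[of "(*s)" "(*s)" g "(*s)" f] by (simp add: o_def)
qed (auto intro: vec.linear_compose_add vec.linear_compose_scale_right)

lemma operator_algebra_preserves_invariant_subspace:
  assumes "f \<in> operator_algebra G" "vec.subspace W" "invariant G W" "x \<in> W"
  shows "f x \<in> W"
  using assms(1,4)
proof (induction arbitrary: x)
  case (gen A)
  then show ?case using assms(3) by (auto simp: invariant_def)
qed (auto intro: vec.subspace_add[OF assms(2)] vec.subspace_scale[OF assms(2)])

lemma operator_algebra_commute:
  assumes "\<And>A B. A \<in> G \<Longrightarrow> B \<in> G \<Longrightarrow> A ** B = B ** A"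
    and f: "f \<in> operator_algebra G" and g: "g \<in> operator_algebra G"
  shows "f (g x) = g (f x)"
proof -
  have gen: "f (A *v x) = A *v f x" if "A \<in> G" for A x
    using f
  proof (induction arbitrary: x)
    case (gen B)
    then show ?case using assms(1)[OF that gen] by (simp add: matrix_vector_mul_assoc)
  qed (simp_all add: vec.add vec.scale)
  note lin = operator_algebra_linear[OF f]
  from g show ?thesis
    by (induction arbitrary: x)
      (simp_all add: gen Vector_Spaces.linear_iff vec.linear_add[OF lin] vec.linear_scale[OF lin])
qed

lemma subspace_orbit_span: "vec.subspace (orbit_span G u)"
  by (simp add: orbit_span_def)

lemma orbit_span_minimal:
  assumes "vec.subspace W" "invariant G W" "v \<in> W"
  shows "orbit_span G v \<subseteq> W"
  unfolding orbit_span_def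
  using assms by (intro vec.span_minimal) (auto simp: orbit_def invariant_def)

section \<open>Polynomials of an operator\<close>

definition poly_op :: "(complex^'n \<Rightarrow> complex^'n) \<Rightarrow> complex poly \<Rightarrow> complex^'n \<Rightarrow> complex^'n" where
  "poly_op f p x = (\<Sum>i\<le>degree p. coeff p i *s (f ^^ i) x)"

lemma poly_op_altdef:
  assumes "degree p \<le> N"
  shows "poly_op f p x = (\<Sum>i\<le>N. coeff p i *s (f ^^ i) x)"
  unfolding poly_op_def using assms
  by (intro sum.mono_neutral_left) (auto simp: coeff_eq_0)

text \<open>
  This is the multiplicativity of evaluation at \<open>f\<close> in the one case needed: splitting off a root of
  a complex polynomial.
\<close>

lemma poly_op_linear_factor:
  assumes lin: "Vector_Spaces.linear (*s) (*s) f"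
  shows "poly_op f ([:- z, 1:] * q) x = f (poly_op f q x) - z *s poly_op f q x"
proof -
  define d where "d = degree q"
  have deg: "degree ([:- z, 1:] * q) \<le> Suc d"
    using degree_mult_le[of "[:- z, 1:]" q] by (simp add: d_def del: mult_pCons_left)
  have "poly_op f ([:- z, 1:] * q) x
      = (\<Sum>i\<le>Suc d. coeff (pCons 0 q) i *s (f ^^ i) x - z *s (coeff q i *s (f ^^ i) x))"
    unfolding poly_op_altdef[OF deg]
    by (intro sum.cong) (simp_all add: vec.scale_left_diff_distrib)
  also have "\<dots> = (\<Sum>i\<le>Suc d. coeff (pCons 0 q) i *s (f ^^ i) x) - z *s poly_op f q x"
    using poly_op_altdef[of q "Suc d" f x]
    by (simp add: sum_subtractf vec.scale_sum_right d_def del: sum.atMost_Suc)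
  also have "(\<Sum>i\<le>Suc d. coeff (pCons 0 q) i *s (f ^^ i) x) = (\<Sum>i\<le>d. f (coeff q i *s (f ^^ i) x))"
    by (simp add: sum.atMost_Suc_shift vec.linear_scale[OF lin] del: sum.atMost_Suc)
  also have "\<dots> = f (poly_op f q x)"
    by (simp add: poly_op_def d_def vec.linear_sum[OF lin])
  finally show ?thesis .
qed

text \<open>
  The \<open>CARD('n) + 1\<close> vectors \<open>x, f x, f (f x), \<dots>\<close> cannot be independent, and a linear relation
  between them is a polynomial that annihilates \<open>x\<close>.
\<close>

lemma ex_annihilating_poly:
  fixes f :: "complex^'n \<Rightarrow> complex^'n"
  obtains p where "p \<noteq> 0" "poly_op f p x = 0"
proof -
  define h where "h i = (f ^^ i) x" for i
  define N where "N = CARD('n)"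
  have "\<exists>c. (\<exists>i\<le>N. c i \<noteq> 0) \<and> (\<Sum>i\<le>N. c i *s h i) = 0"
  proof (cases "inj_on h {..N}")
    case False
    then obtain i j where ij: "i \<le> N" "j \<le> N" "i \<noteq> j" "h i = h j"
      by (auto simp: inj_on_def)
    have "(\<Sum>k\<le>N. ((if k = i then 1 else 0) - (if k = j then 1 else 0)) *s h k)
        = (\<Sum>k\<le>N. (if k = i then h k else 0) - (if k = j then h k else 0))"
      by (intro sum.cong) auto
    also have "\<dots> = 0"
      using ij by (simp add: sum_subtractf)
    finally show ?thesis
      using ij by (intro exI[of _ "\<lambda>k. (if k = i then 1 else 0) - (if k = j then 1 else 0)"])
        auto
  next
    case True
    then have "card (h ` {..N}) = Suc N"
      by (simp add: card_image)
    then have "vec.dim (h ` {..N}) < card (h ` {..N})"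
      using dim_subset_UNIV_cart_gen[of "h ` {..N}"] by (simp add: N_def)
    then have "vec.dependent (h ` {..N})"
      by (intro vec.dependent_biggerset_general)
    then obtain w where "\<exists>v\<in>h ` {..N}. w v \<noteq> 0" "(\<Sum>v\<in>h ` {..N}. w v *s v) = 0"
      by (subst (asm) vec.dependent_finite) auto
    then show ?thesis
      using True by (intro exI[of _ "w \<circ> h"]) (auto simp: sum.reindex)
  qed
  then obtain c where c: "\<exists>i\<le>N. c i \<noteq> 0" "(\<Sum>i\<le>N. c i *s h i) = 0"
    by blast
  define p where "p = (\<Sum>i\<le>N. monom (c i) i)"
  have coeff: "coeff p i = (if i \<le> N then c i else 0)" for i
    by (simp add: p_def coeff_sum)
  have "degree p \<le> N"
    by (intro degree_le) (simp add: coeff)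
  then have "poly_op f p x = 0"
    using c(2) by (simp add: poly_op_altdef coeff h_def)
  moreover have "p \<noteq> 0"
    using c(1) coeff by (metis coeff_0)
  ultimately show thesis
    using that by blast
qed

section \<open>Orbits of an abelian group of matrices\<close>

locale abelian_matrix_group =
  fixes G :: "(complex^'n^'n) set"
  assumes abelian: "abelian_subgroup_GL G"
begin

lemma one_closed: "mat 1 \<in> G"
  and mult_closed: "A \<in> G \<Longrightarrow> B \<in> G \<Longrightarrow> A ** B \<in> G"
  and commute: "A \<in> G \<Longrightarrow> B \<in> G \<Longrightarrow> A ** B = B ** A"
  using abelian subgroup.one_closed[of G GL] subgroup.m_closed[of G GL]
  by (auto simp: abelian_subgroup_GL_def GL_def)

lemma left_inverse:
  assumes "A \<in> G"
  obtains B where "B \<in> G" "B ** A = mat 1"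
proof -
  interpret subgroup G GL
    using abelian by (simp add: abelian_subgroup_GL_def)
  show thesis
    using that[of "inv\<^bsub>GL\<^esub> A"] m_inv_closed[OF assms] group.l_inv[OF group_GL] assms subset
    by (auto simp: GL_def)
qed

lemma algebra_commute:
  "f \<in> operator_algebra G \<Longrightarrow> g \<in> operator_algebra G \<Longrightarrow> f (g x) = g (f x)"
  by (rule operator_algebra_commute[of G]) (rule commute)

lemma in_orbit_self: "v \<in> orbit G v"
  unfolding orbit_def using one_closed by (auto intro!: exI[of _ "mat 1"])

lemma in_orbit_span_self: "v \<in> orbit_span G v"
  unfolding orbit_span_def using in_orbit_self by (rule vec.span_base)

lemma orbit_translate:
  assumes "A \<in> G"
  shows "orbit G (A *v v) = orbit G v"
proof -
  obtain B where B: "B \<in> G" "B ** A = mat 1"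
    using left_inverse[OF assms] .
  have "\<exists>D\<in>G. C *v v = (D ** A) *v v" if "C \<in> G" for C
    using that B mult_closed by (metis matrix_mul_assoc matrix_mul_rid)
  then show ?thesis
    using assms mult_closed by (fastforce simp: orbit_def matrix_vector_mul_assoc)
qed

lemma invariant_orbit_span: "invariant G (orbit_span G v)"
proof -
  have "A *v x \<in> orbit_span G v" if "A \<in> G" "x \<in> orbit_span G v" for A x
    using that(2) unfolding orbit_span_def
  proof (induction rule: vec.span_induct_alt)
    case (step c y z)
    have "A *v y \<in> orbit G v"
      using step(1) that(1) mult_closed by (auto simp: orbit_def matrix_vector_mul_assoc)
    then show ?case
      using step(2) by (simp add: vec.add vec.scale vec.span_add vec.span_scale vec.span_base)
  qed (simp add: vec.span_zero)
  then show ?thesis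
    by (auto simp: invariant_def)
qed

lemma algebra_id: "(\<lambda>x. x) \<in> operator_algebra G"
proof -
  have "(*v) (mat 1 :: complex^'n^'n) = (\<lambda>x. x)"
    by (simp add: fun_eq_iff)
  then show ?thesis
    using operator_algebra.gen[OF one_closed] by simp
qed

lemma algebra_diff_scalar:
  assumes "f \<in> operator_algebra G"
  shows "(\<lambda>x. f x - z *s x) \<in> operator_algebra G"
  using operator_algebra.add[OF assms operator_algebra.scale[OF algebra_id, of "- z"]] by simp

lemma algebra_poly_op:
  assumes f: "f \<in> operator_algebra G"
  shows "poly_op f p \<in> operator_algebra G"
proof -
  have pow: "f ^^ i \<in> operator_algebra G" for i
    using algebra_id operator_algebra.comp[OF f] by (induction i) (simp_all add: id_def o_def)
  have "(\<lambda>x. \<Sum>i\<le>n. coeff p i *s (f ^^ i) x) \<in> operator_algebra G" for n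
  proof (induction n)
    case 0
    show ?case
      using operator_algebra.scale[OF pow[of 0]] by simp
  next
    case (Suc n)
    show ?case
      unfolding sum.atMost_Suc
      by (rule operator_algebra.add[OF Suc operator_algebra.scale[OF pow]])
  qed
  then show ?thesis
    by (simp add: poly_op_def[abs_def])
qed

text \<open>
  The values at \<open>u\<close> of the operators form a subspace that contains the orbit; conversely,
  operators of the algebra do not lead out of the invariant subspace spanned by the orbit.
\<close>

lemma orbit_span_eq: "orbit_span G u = (\<lambda>f. f u) ` operator_algebra G"
proof
  have "vec.subspace ((\<lambda>f. f u) ` operator_algebra G)"
  proof (rule vec.subspaceI)
    show "0 \<in> (\<lambda>f. f u) ` operator_algebra G"
      using operator_algebra.scale[OF algebra_id, of 0] by (auto intro: rev_image_eqI)
  qed (auto intro: rev_image_eqI[OF operator_algebra.add] rev_image_eqI[OF operator_algebra.scale])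
  moreover have "orbit G u \<subseteq> (\<lambda>f. f u) ` operator_algebra G"
    by (auto simp: orbit_def intro: rev_image_eqI[OF operator_algebra.gen])
  ultimately show "orbit_span G u \<subseteq> (\<lambda>f. f u) ` operator_algebra G"
    unfolding orbit_span_def by (rule vec.span_minimal[rotated])
next
  show "(\<lambda>f. f u) ` operator_algebra G \<subseteq> orbit_span G u"
    using operator_algebra_preserves_invariant_subspace[OF _ subspace_orbit_span invariant_orbit_span]
      in_orbit_span_self by blast
qed


section \<open>Invariant hyperplanes\<close>

definition invariant_hyperplanes :: "complex^'n \<Rightarrow> (complex^'n) set set" where
  "invariant_hyperplanes u = {W. vec.subspace W \<and> W \<subseteq> orbit_span G u \<and> invariant G W \<and>
     vec.dim W + 1 = orbit_rank G u}"

lemma generator_notin_hyperplane: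
  assumes "W \<in> invariant_hyperplanes u" "orbit_span G v = orbit_span G u"
  shows "v \<notin> W"
proof
  assume "v \<in> W"
  then have "orbit_span G u \<subseteq> W"
    using assms orbit_span_minimal[of W G v] by (auto simp: invariant_hyperplanes_def)
  then have "W = orbit_span G u"
    using assms by (auto simp: invariant_hyperplanes_def)
  then show False
    using assms by (simp add: invariant_hyperplanes_def orbit_rank_def)
qed

lemma span_insert_hyperplane:
  assumes W: "W \<in> invariant_hyperplanes u"
  shows "vec.span (insert u W) = orbit_span G u"
proof (rule vec.subspace_dim_equal)
  have W': "vec.subspace W" "W \<subseteq> orbit_span G u" "vec.dim W + 1 = vec.dim (orbit_span G u)"
    using W by (auto simp: invariant_hyperplanes_def orbit_rank_def)
  show "vec.span (insert u W) \<subseteq> orbit_span G u"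
    using W' subspace_orbit_span in_orbit_span_self by (intro vec.span_minimal) auto
  have "u \<notin> vec.span W"
    unfolding vec.span_eq_iff[THEN iffD2, OF W'(1)] by (rule generator_notin_hyperplane[OF W refl])
  then show "vec.dim (orbit_span G u) \<le> vec.dim (vec.span (insert u W))"
    using W'(3) by (simp add: vec.dim_span vec.dim_insert)
qed (simp_all add: subspace_orbit_span)

text \<open>
  This is the existence of an eigenvalue of the transpose of \<open>f\<close> on the quotient of the span by
  \<open>W\<close>, phrased without quotients. If every \<open>f - z\<close> were onto modulo \<open>W\<close>, so would be every nonzero
  polynomial in \<open>f\<close>, as it is a product of a nonzero constant and such factors. But a polynomial
  that annihilates \<open>u\<close> annihilates the whole span.
\<close>

lemma ex_shift_not_onto:
  assumes f: "f \<in> operator_algebra G"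
    and W: "vec.subspace W" "invariant G W" and u: "u \<notin> W"
  shows "\<exists>z. \<forall>x\<in>orbit_span G u. u - (f x - z *s x) \<notin> W"
proof (rule ccontr)
  assume "\<not> ?thesis"
  then have onto: "\<exists>g\<in>operator_algebra G. u - (f (g u) - z *s g u) \<in> W" for z
    by (fastforce simp: orbit_span_eq)
  note preserve = operator_algebra_preserves_invariant_subspace[OF _ W]
  have *: "\<exists>h\<in>operator_algebra G. u - poly_op f p (h u) \<in> W" if "p \<noteq> 0" for p
    using that
  proof (induction "degree p" arbitrary: p rule: less_induct)
    case less
    show ?case
    proof (cases "degree p = 0")
      case True
      then obtain a where a: "p = [:a:]" "a \<noteq> 0"
        using less.prems by (metis degree_eq_zeroE pCons_0_0)
      then show ?thesis
        using vec.subspace_0[OF W(1)]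
        by (intro bexI[OF _ operator_algebra.scale[OF algebra_id, of "1 / a"]])
          (simp add: poly_op_def)
    next
      case False
      then obtain z where "poly p z = 0"
        using fundamental_theorem_of_algebra_alt[of p] by fastforce
      then obtain q where pq: "p = [:- z, 1:] * q"
        by (auto simp: poly_eq_0_iff_dvd elim!: dvdE)
      then have "q \<noteq> 0"
        using less.prems by auto
      then have "degree q < degree p"
        unfolding pq by (subst degree_mult_eq) auto
      with \<open>q \<noteq> 0\<close> obtain h where h: "h \<in> operator_algebra G" "u - poly_op f q (h u) \<in> W"
        using less.hyps by blast
      obtain g where g: "g \<in> operator_algebra G" "u - (f (g u) - z *s g u) \<in> W"
        using onto by blast
      define k where "k = (\<lambda>x. f (g x) - z *s g x)"
      have k: "k \<in> operator_algebra G"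
        unfolding k_def using operator_algebra.comp[OF algebra_diff_scalar[OF f] g(1)] .
      note lin = operator_algebra_linear[OF k]
      \<comment> \<open>Being onto modulo \<open>W\<close> need only be checked at \<open>u\<close>: if \<open>f - z\<close> reaches \<open>u\<close> from \<open>g u\<close>,
        then it reaches any \<open>x\<close> in the span from \<open>g x\<close>.\<close>
      have "poly_op f p (g (h u)) = k (poly_op f q (h u))"
        unfolding pq poly_op_linear_factor[OF operator_algebra_linear[OF f]] k_def
        using algebra_commute[OF algebra_poly_op[OF f, of q] g(1)] by simp
      then have "u - poly_op f p (g (h u)) = (u - k u) + k (u - poly_op f q (h u))"
        by (simp add: vec.linear_diff[OF lin])
      also have "\<dots> \<in> W"
        using g(2) preserve[OF k h(2)] by (intro vec.subspace_add[OF W(1)]) (simp_all add: k_def)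
      finally show ?thesis
        by (rule bexI[OF _ operator_algebra.comp[OF g(1) h(1)]])
    qed
  qed
  obtain p where p: "p \<noteq> 0" "poly_op f p u = 0"
    by (rule ex_annihilating_poly)
  obtain h where h: "h \<in> operator_algebra G" "u - poly_op f p (h u) \<in> W"
    using *[OF p(1)] by blast
  have "poly_op f p (h u) = h (poly_op f p u)"
    using algebra_commute[OF algebra_poly_op[OF f] h(1)] by blast
  also have "\<dots> = 0"
    using p(2) vec.linear_0[OF operator_algebra_linear[OF h(1)]] by simp
  finally show False
    using h(2) u by simp
qed

text \<open>
  Among the proper invariant subspaces above \<open>V\<close>, one of maximal dimension is a hyperplane. For
  \<open>A \<in> G\<close> and \<open>z\<close> such that \<open>A - z\<close> is not onto modulo \<open>W\<close>, the subspace \<open>(A - z) E + W\<close> is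
  invariant and still proper, so it is \<open>W\<close> itself. Hence \<open>A u\<close> is a multiple of \<open>u\<close> modulo \<open>W\<close>, and
  \<open>W\<close> together with \<open>u\<close> spans everything. Properness is expressed by \<open>u \<notin> V\<close>, which for
  invariant subspaces of the span means the same.
\<close>

lemma ex_invariant_hyperplane:
  assumes V: "vec.subspace V" "invariant G V" "V \<subseteq> orbit_span G u" "u \<notin> V"
  obtains W where "W \<in> invariant_hyperplanes u" "V \<subseteq> W"
proof -
  let ?E = "orbit_span G u"
  define P where
    "P W \<longleftrightarrow> vec.subspace W \<and> invariant G W \<and> V \<subseteq> W \<and> W \<subseteq> ?E \<and> u \<notin> W" for W
  have "\<exists>W. P W \<and> (\<forall>X. P X \<longrightarrow> vec.dim X \<le> vec.dim W)"
    using V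
    by (intro ex_has_greatest_nat[of P V vec.dim "Suc CARD('n)"])
      (auto simp: P_def less_Suc_eq_le dim_subset_UNIV_cart_gen)
  then obtain W where W: "P W" and max: "\<And>X. P X \<Longrightarrow> vec.dim X \<le> vec.dim W"
    by blast
  have sub: "vec.subspace W"
    using W by (simp add: P_def)
  have scalar: "\<exists>z. A *v u - z *s u \<in> W" if A: "A \<in> G" for A
  proof -
    obtain z where z: "\<And>x. x \<in> ?E \<Longrightarrow> u - (A *v x - z *s x) \<notin> W"
      using ex_shift_not_onto[OF operator_algebra.gen[OF A], of W u] W by (auto simp: P_def)
    define g where "g = (\<lambda>x. A *v x - z *s x)"
    have g: "g \<in> operator_algebra G"
      unfolding g_def using algebra_diff_scalar[OF operator_algebra.gen[OF A]] .
    note lin = operator_algebra_linear[OF g]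
    define X where "X = {a + b |a b. a \<in> g ` ?E \<and> b \<in> W}"
    have WX: "W \<subseteq> X"
    proof
      fix x assume "x \<in> W"
      moreover have "x = g 0 + x"
        by (simp add: vec.linear_0[OF lin])
      ultimately show "x \<in> X"
        using vec.subspace_0[OF subspace_orbit_span[of G u]] unfolding X_def by blast
    qed
    have gX: "g u \<in> X"
      unfolding X_def mem_Collect_eq
      using in_orbit_span_self[of u] vec.subspace_0[OF sub]
      by (intro exI[of _ "g u"] exI[of _ "0 :: complex^'n"]) simp
    have "P X"
      unfolding P_def
    proof (intro conjI)
      show "vec.subspace X"
        unfolding X_def
        by (intro vec.subspace_sums vec.linear_subspace_image[OF lin] subspace_orbit_span sub)
      show "invariant G X"
        unfolding invariant_def
      proof safe
        fix B x assume B: "B \<in> G" and "x \<in> X"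
        then obtain y b where x: "x = g y + b" "y \<in> ?E" "b \<in> W"
          by (auto simp: X_def)
        have "B *v x = g (B *v y) + B *v b"
          using algebra_commute[OF g operator_algebra.gen[OF B]] x(1) by (simp add: vec.add)
        moreover have "B *v y \<in> ?E" "B *v b \<in> W"
          using x(2,3) B invariant_orbit_span[of u] W unfolding invariant_def P_def by blast+
        ultimately show "B *v x \<in> X"
          by (auto simp: X_def)
      qed
      show "V \<subseteq> X"
        using W WX by (auto simp: P_def)
      have "g x \<in> ?E" if "x \<in> ?E" for x
        by (rule operator_algebra_preserves_invariant_subspace
            [OF g subspace_orbit_span invariant_orbit_span that])
      then show "X \<subseteq> ?E"
        using W by (auto simp: X_def P_def intro!: vec.subspace_add[OF subspace_orbit_span])
      show "u \<notin> X"
      proof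
        assume "u \<in> X"
        then obtain x b where "u = g x + b" "x \<in> ?E" "b \<in> W"
          by (auto simp: X_def)
        then show False
          using z[of x] by (simp add: g_def)
      qed
    qed
    then have "W = X"
      using max sub WX by (intro vec.subspace_dim_equal) (auto simp: P_def)
    then show ?thesis
      using gX by (auto simp: g_def)
  qed
  have span_W: "vec.span W = W"
    using sub by (simp add: vec.span_eq_iff)
  have "orbit G u \<subseteq> vec.span (insert u W)"
    using scalar by (auto simp: orbit_def vec.span_insert span_W)
  then have "?E \<subseteq> vec.span (insert u W)"
    unfolding orbit_span_def by (intro vec.span_minimal) simp_all
  moreover have "vec.span (insert u W) \<subseteq> ?E"
    using W subspace_orbit_span in_orbit_span_self
    by (intro vec.span_minimal) (auto simp: P_def)
  ultimately have "vec.dim ?E = vec.dim (vec.span (insert u W))"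
    by simp
  also have "\<dots> = vec.dim W + 1"
    using W by (simp add: vec.dim_insert span_W P_def)
  finally have "W \<in> invariant_hyperplanes u"
    using W by (simp add: invariant_hyperplanes_def P_def orbit_rank_def)
  then show thesis
    using that W by (auto simp: P_def)
qed

text \<open>
  Modulo \<open>W\<close> the vector \<open>g u\<close> is a nonzero multiple of \<open>u\<close>, so applying \<open>f\<close> to it is, modulo \<open>W\<close>,
  the same as applying \<open>f\<close> to a nonzero multiple of \<open>u\<close>.
\<close>

lemma invariant_hyperplane_prime:
  assumes W: "W \<in> invariant_hyperplanes u"
    and f: "f \<in> operator_algebra G" "f u \<notin> W" and g: "g \<in> operator_algebra G" "g u \<notin> W"
  shows "f (g u) \<notin> W"
proof
  assume fg: "f (g u) \<in> W"
  have sub: "vec.subspace W" and inv: "invariant G W"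
    using W by (auto simp: invariant_hyperplanes_def)
  have span_W: "vec.span W = W"
    using sub by (simp add: vec.span_eq_iff)
  have "g u \<in> vec.span (insert u W)"
    using span_insert_hyperplane[OF W] g(1) by (simp add: orbit_span_eq)
  then obtain c where c: "g u - c *s u \<in> W"
    by (auto simp: vec.span_insert span_W)
  with g(2) have "c \<noteq> 0"
    by auto
  note lin = operator_algebra_linear[OF f(1)]
  have "f (g u - c *s u) \<in> W"
    using operator_algebra_preserves_invariant_subspace[OF f(1) sub inv c] .
  then have "f (g u) - f (g u - c *s u) \<in> W"
    using fg vec.subspace_diff[OF sub] by blast
  then have "c *s f u \<in> W"
    by (simp add: vec.linear_diff[OF lin] vec.linear_scale[OF lin])
  then have "(1 / c) *s (c *s f u) \<in> W"
    by (rule vec.subspace_scale[OF sub])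
  then show False
    using f(2) \<open>c \<noteq> 0\<close> by simp
qed

text \<open>
  Each \<open>X \<in> F\<close> contains some \<open>g u\<close> outside \<open>W\<close>, since \<open>X\<close> and \<open>W\<close> are different and have the same
  dimension. The product of these operators works by primality of \<open>W\<close>.
\<close>

lemma ex_operator_avoiding:
  assumes "finite F" "F \<subseteq> invariant_hyperplanes u" "W \<in> invariant_hyperplanes u" "W \<notin> F"
  shows "\<exists>f\<in>operator_algebra G. f u \<in> \<Inter>F \<and> f u \<notin> W"
  using assms(1,2,4)
proof (induction F rule: finite_induct)
  case empty
  show ?case
    using algebra_id generator_notin_hyperplane[OF assms(3) refl] by auto
next
  case (insert X F)
  then obtain f where f: "f \<in> operator_algebra G" "f u \<in> \<Inter>F" "f u \<notin> W"
    by auto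
  have X: "X \<in> invariant_hyperplanes u" "X \<noteq> W"
    using insert.prems by auto
  have "\<not> X \<subseteq> W"
    using X assms(3) vec.subspace_dim_equal[of X W] by (auto simp: invariant_hyperplanes_def)
  then obtain g where g: "g \<in> operator_algebra G" "g u \<in> X" "g u \<notin> W"
    using X(1) by (force simp: invariant_hyperplanes_def orbit_span_eq)
  have "f (g u) \<notin> W"
    using invariant_hyperplane_prime[OF assms(3) f(1,3) g(1,3)] .
  moreover have "f (g u) \<in> X"
    using operator_algebra_preserves_invariant_subspace[OF f(1) _ _ g(2)] X(1)
    by (auto simp: invariant_hyperplanes_def)
  moreover have "f (g u) \<in> Y" if "Y \<in> F" for Y
    using operator_algebra_preserves_invariant_subspace[OF g(1), of Y "f u"] that f(2) insert.prems
    by (auto simp: invariant_hyperplanes_def algebra_commute[OF f(1) g(1)])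
  ultimately show ?case
    using operator_algebra.comp[OF f(1) g(1)] by (intro bexI[where x="\<lambda>x. f (g x)"]) auto
qed

text \<open>
  The dimension of the intersection drops by at least 1 with every further hyperplane.
\<close>

lemma card_invariant_hyperplanes:
  "finite (invariant_hyperplanes u) \<and> card (invariant_hyperplanes u) \<le> orbit_rank G u"
proof (rule finite_if_finite_subsets_card_bdd)
  fix F assume "F \<subseteq> invariant_hyperplanes u" "finite F"
  from this(2,1) have "vec.dim (orbit_span G u \<inter> \<Inter>F) + card F \<le> orbit_rank G u"
  proof (induction F rule: finite_induct)
    case empty
    then show ?case by (simp add: orbit_rank_def)
  next
    case (insert W F)
    let ?I = "orbit_span G u \<inter> \<Inter>F"
    have sub: "vec.subspace (orbit_span G u \<inter> \<Inter>F')" if "F' \<subseteq> invariant_hyperplanes u" for F'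
      using that subspace_orbit_span
      by (intro vec.subspace_inter vec.subspace_Inter) (auto simp: invariant_hyperplanes_def)
    obtain f where f: "f \<in> operator_algebra G" "f u \<in> \<Inter>F" "f u \<notin> W"
      using ex_operator_avoiding[of F u W] insert by auto
    then have "f u \<in> ?I"
      by (auto simp: orbit_span_eq)
    then have "orbit_span G u \<inter> \<Inter>(insert W F) \<subset> ?I"
      using f(3) by auto
    then have "vec.dim (orbit_span G u \<inter> \<Inter>(insert W F)) < vec.dim ?I"
      using sub[of F] sub[of "insert W F"] insert.prems
      by (intro vec.dim_psubset) (simp add: vec.span_eq_iff[THEN iffD2])
    then show ?case
      using insert by simp
  qed
  then show "card F \<le> orbit_rank G u"
    by simp
qed

section \<open>Vectors that generate the same subspace\<close>

definition generators :: "complex^'n \<Rightarrow> (complex^'n) set" where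
  "generators u = {v. orbit_span G v = orbit_span G u}"

lemma generators_subset: "generators u \<subseteq> orbit_span G u"
  using in_orbit_span_self by (auto simp: generators_def)

text \<open>
  A vector \<open>v\<close> that does not generate the span lies in its own, proper, invariant subspace
  \<open>orbit_span G v\<close>, which extends to an invariant hyperplane.
\<close>

lemma generators_complement: "orbit_span G u - generators u = \<Union>(invariant_hyperplanes u)"
proof (intro equalityI subsetI)
  fix v assume v: "v \<in> orbit_span G u - generators u"
  have sub: "orbit_span G v \<subseteq> orbit_span G u"
    using v by (intro orbit_span_minimal subspace_orbit_span invariant_orbit_span) auto
  have "u \<notin> orbit_span G v"
  proof
    assume "u \<in> orbit_span G v"
    then have "orbit_span G u \<subseteq> orbit_span G v"
      by (intro orbit_span_minimal subspace_orbit_span invariant_orbit_span)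
    then show False
      using v sub by (auto simp: generators_def)
  qed
  then obtain W where "W \<in> invariant_hyperplanes u" "orbit_span G v \<subseteq> W"
    using ex_invariant_hyperplane[OF subspace_orbit_span invariant_orbit_span sub] by blast
  then show "v \<in> \<Union>(invariant_hyperplanes u)"
    using in_orbit_span_self by blast
next
  fix v assume "v \<in> \<Union>(invariant_hyperplanes u)"
  then show "v \<in> orbit_span G u - generators u"
    using generator_notin_hyperplane by (auto simp: generators_def invariant_hyperplanes_def)
qed

text \<open>
  Operators \<open>f\<close> and \<open>g\<close> with \<open>f v = w\<close> and \<open>g w = v\<close> are inverse to each other on the whole span:
  there every vector is \<open>h v\<close> for some operator \<open>h\<close>, which commutes with both.
\<close>

lemma isomorphic_orbits_of_same_span:
  assumes same: "orbit_span G v = orbit_span G w"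
  shows "isomorphic_orbits G v w"
proof -
  let ?E = "orbit_span G v"
  have "w \<in> ?E" "v \<in> orbit_span G w"
    using in_orbit_span_self[of v] in_orbit_span_self[of w] unfolding same by blast+
  then obtain f g where f: "f \<in> operator_algebra G" "f v = w"
    and g: "g \<in> operator_algebra G" "g w = v"
    unfolding orbit_span_eq by (elim imageE) metis
  note lin = operator_algebra_linear[OF f(1)]
  have maps: "f x \<in> ?E" "g x \<in> ?E" if "x \<in> ?E" for x
    by (rule operator_algebra_preserves_invariant_subspace[OF _ subspace_orbit_span
        invariant_orbit_span that], fact f(1) g(1))+
  have inverse: "g (f x) = x" if "x \<in> ?E" for x
  proof -
    obtain h where h: "h \<in> operator_algebra G" "x = h v"
      using \<open>x \<in> ?E\<close> unfolding orbit_span_eq by (elim imageE)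
    have "g (f x) = h (g (f v))"
      unfolding h(2) by (rule algebra_commute[OF operator_algebra.comp[OF g(1) f(1)] h(1)])
    then show ?thesis
      unfolding f(2) g(2) h(2) .
  qed
  have "bij_betw f ?E ?E"
    by (rule bij_betw_byWitness[where f' = g])
      (auto simp: maps inverse algebra_commute[OF f(1) g(1)])
  then have "linear_iso_between f (orbit_span G v) (orbit_span G w)"
    unfolding linear_iso_between_def same[symmetric]
    by (simp add: vec.linear_add[OF lin] vec.linear_scale[OF lin])
  moreover have "f (A *v v) = A *v w" if "A \<in> G" for A
    using algebra_commute[OF f(1) operator_algebra.gen[OF that]] f(2) by simp
  then have "f ` orbit G v = orbit G w"
    by (simp add: orbit_def Setcompr_eq_image image_image)
  ultimately show ?thesis
    by (auto simp: isomorphic_orbits_def)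
qed

lemma invariant_generators: "invariant G (generators u)"
  using orbit_translate by (auto simp: invariant_def generators_def orbit_span_def)

lemma openin_generators: "openin (top_of_set (orbit_span G u)) (generators u)"
proof -
  have "closed (\<Union>(invariant_hyperplanes u))"
    using card_invariant_hyperplanes closed_complex_subspace
    by (intro closed_Union) (auto simp: invariant_hyperplanes_def)
  moreover have "generators u = orbit_span G u - \<Union>(invariant_hyperplanes u)"
    using generators_complement generators_subset by blast
  ultimately show ?thesis
    by (metis Diff_eq closed_def openin_open_Int)
qed

text \<open>
  The points \<open>x + t u\<close> with small real \<open>t > 0\<close> approach \<open>x\<close>. As \<open>u\<close> lies in no invariant
  hyperplane, each hyperplane contains at most one of them, so only finitely many of them fail to
  be generators.
\<close>

lemma generators_dense: "orbit_span G u \<subseteq> closure (generators u)"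
proof
  fix x assume x: "x \<in> orbit_span G u"
  define T where "T W = {t::real. x + t *\<^sub>R u \<in> W}" for W
  have "finite (T W)" if W: "W \<in> invariant_hyperplanes u" for W
  proof -
    have sub: "subspace W"
      using W real_subspace_of_complex_subspace by (auto simp: invariant_hyperplanes_def)
    have "s = t" if "s \<in> T W" "t \<in> T W" for s t
    proof (rule ccontr)
      assume "s \<noteq> t"
      have "(x + s *\<^sub>R u) - (x + t *\<^sub>R u) \<in> W"
        using that unfolding T_def mem_Collect_eq by (rule subspace_diff[OF sub])
      then have "(1 / (s - t)) *\<^sub>R ((s - t) *\<^sub>R u) \<in> W"
        using subspace_scale[OF sub] by (simp add: scaleR_diff_left)
      then show False
        using \<open>s \<noteq> t\<close> generator_notin_hyperplane[OF W refl] by simp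
    qed
    then show ?thesis
      by (metis finite.simps is_singletonI' is_singleton_def)
  qed
  then have fin: "finite (\<Union>(T ` invariant_hyperplanes u))"
    using card_invariant_hyperplanes by auto
  show "x \<in> closure (generators u)"
    unfolding closure_approachable
  proof (intro allI impI)
    fix e :: real assume "e > 0"
    \<comment> \<open>The summand 1 covers the case \<open>u = 0\<close>.\<close>
    define d where "d = e / (norm u + 1)"
    have "d > 0"
      using \<open>e > 0\<close> by (simp add: d_def add_nonneg_pos)
    then have "infinite ({0<..<d} - \<Union>(T ` invariant_hyperplanes u))"
      using fin by (intro Diff_infinite_finite) simp_all
    then obtain t where t: "0 < t" "t < d" "t \<notin> \<Union>(T ` invariant_hyperplanes u)"
      by (metis DiffD1 DiffD2 all_not_in_conv finite.emptyI greaterThanLessThan_iff)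
    let ?y = "x + t *\<^sub>R u"
    have "?y \<in> orbit_span G u"
      using x in_orbit_span_self real_subspace_of_complex_subspace[OF subspace_orbit_span]
      by (intro subspace_add subspace_scale) auto
    moreover have "?y \<notin> \<Union>(invariant_hyperplanes u)"
      using t(3) by (auto simp: T_def)
    ultimately have "?y \<in> generators u"
      using generators_complement by blast
    moreover have "dist ?y x = t * norm u"
      using t(1) by (simp add: dist_norm)
    moreover have "t * norm u < e"
    proof -
      have "t * norm u \<le> t * (norm u + 1)"
        using t(1) by simp
      also have "\<dots> < e"
        using t(2) by (simp add: d_def pos_less_divide_eq add_nonneg_pos)
      finally show ?thesis .
    qed
    ultimately show "\<exists>y\<in>generators u. dist y x < e"
      by (metis)
  qed
qed

end

theorem theorem1p1:
  fixes G :: "(complex^'n^'n) set"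
  assumes "abelian_subgroup_GL G"
  shows "\<forall>u :: complex^'n. \<exists>U.
      u \<in> U \<and> invariant G U \<and>
      openin (top_of_set (orbit_span G u)) U \<and>
      (top_of_set (orbit_span G u)) closure_of U = orbit_span G u \<and>
      (\<forall>v\<in>U. orbit_span G v = orbit_span G u) \<and>
      (\<forall>v\<in>U. \<forall>w\<in>U. isomorphic_orbits G v w) \<and>
      (\<exists>\<F>. finite \<F> \<and> card \<F> \<le> orbit_rank G u \<and>
           (\<forall>W\<in>\<F>. vec.subspace W \<and> W \<subseteq> orbit_span G u \<and> invariant G W \<and>
                    vec.dim W + 1 = orbit_rank G u) \<and>
           orbit_span G u - U = \<Union>\<F>)"
proof
  fix u :: "complex^'n"
  interpret abelian_matrix_group G
    by standard (rule assms)
  have "(top_of_set (orbit_span G u)) closure_of generators u = orbit_span G u"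
    using generators_dense[of u] generators_subset[of u]
    by (simp add: closure_of_subtopology Int_absorb1 Int_absorb2)
  moreover have "isomorphic_orbits G v w" if "v \<in> generators u" "w \<in> generators u" for v w
    using that by (intro isomorphic_orbits_of_same_span) (simp add: generators_def)
  moreover have "\<forall>W\<in>invariant_hyperplanes u. vec.subspace W \<and> W \<subseteq> orbit_span G u \<and>
      invariant G W \<and> vec.dim W + 1 = orbit_rank G u"
    by (simp add: invariant_hyperplanes_def)
  ultimately show "\<exists>U.
      u \<in> U \<and> invariant G U \<and>
      openin (top_of_set (orbit_span G u)) U \<and>
      (top_of_set (orbit_span G u)) closure_of U = orbit_span G u \<and>
      (\<forall>v\<in>U. orbit_span G v = orbit_span G u) \<and>
      (\<forall>v\<in>U. \<forall>w\<in>U. isomorphic_orbits G v w) \<and>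
      (\<exists>\<F>. finite \<F> \<and> card \<F> \<le> orbit_rank G u \<and>
           (\<forall>W\<in>\<F>. vec.subspace W \<and> W \<subseteq> orbit_span G u \<and> invariant G W \<and>
                    vec.dim W + 1 = orbit_rank G u) \<and>
           orbit_span G u - U = \<Union>\<F>)"
    using invariant_generators openin_generators generators_complement card_invariant_hyperplanes
    by (intro exI[of _ "generators u"] conjI exI[of _ "invariant_hyperplanes u"])
      (auto simp: generators_def)
qed

end
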